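(* Let $\Sigma$ be a surface (a $2$-dimensional manifold) embedded in Euclidean space $\mathbb{R}^m$, with embedding coordinates $x^1,\dots,x^m$ regarded as functions of local coordinates $u^1,u^2$ on $\Sigma$, and let $\{\cdot,\cdot\}$ be the Poisson bracket $$\{f,h\}=\frac{1}{\sqrt g}\left(\frac{\partial f}{\partial u^1}\frac{\partial h}{\partial u^2}-\frac{\partial h}{\partial u^1}\frac{\partial f}{\partial u^2}\right),$$ where $g$ is the determinant of the induced metric tensor. Then the Gaussian curvature $K$ of $\Sigma$ (with the induced metric) is $$K=\sum_{j,k,l=1}^m\left(\frac12\{\{x^j,x^k\},x^k\}\{\{x^j,x^l\},x^l\}-\frac14\{\{x^j,x^k\},x^l\}\{\{x^j,x^k\},x^l\}\right).$$
   Context: The induced metric is $g_{ab}=\sum_{i=1}^m(\partial_a x^i)(\partial_b x^i)$, $a,b\in\{1,2\}$, and $g=\det(g_{ab})$. The coordinates $x^i$ are the Cartesian coordinates of $\mathbb{R}^m$. *)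

theory Defs
  imports "HOL-Analysis.Analysis"
begin

text \<open>
  Local coordinates \<open>(u\<^sup>1, u\<^sup>2)\<close> are points of \<^typ>\<open>real^2\<close>. Partial derivatives are directional
  values of the Frechet derivative; they are used only for functions that are differentiable at
  the point in question.
\<close>

definition partial :: "2 \<Rightarrow> (real^2 \<Rightarrow> 'b::real_normed_vector) \<Rightarrow> real^2 \<Rightarrow> 'b" where
  "partial a f u = frechet_derivative f (at u) (axis a 1)"

primrec Ck_on :: "nat \<Rightarrow> (real^2) set \<Rightarrow> (real^2 \<Rightarrow> 'b::real_normed_vector) \<Rightarrow> bool" where
  "Ck_on 0 U f = continuous_on U f"
| "Ck_on (Suc n) U f = ((\<forall>u\<in>U. f differentiable at u) \<and> (\<forall>a. Ck_on n U (partial a f)))"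

definition smooth_on :: "(real^2) set \<Rightarrow> (real^2 \<Rightarrow> 'b::real_normed_vector) \<Rightarrow> bool" where
  "smooth_on U f \<longleftrightarrow> (\<forall>n. Ck_on n U f)"

definition local_parametrization ::
    "(real^'m) set \<Rightarrow> (real^2) set \<Rightarrow> (real^2 \<Rightarrow> real^'m) \<Rightarrow> bool" where
  "local_parametrization S U x \<longleftrightarrow>
     open U \<and> smooth_on U x \<and>
     (\<forall>u\<in>U. inj (frechet_derivative x (at u))) \<and>
     (\<exists>y. homeomorphism U (x ` U) x y) \<and>
     openin (top_of_set S) (x ` U)"

definition embedded_surface :: "(real^'m) set \<Rightarrow> bool" where
  "embedded_surface S \<longleftrightarrow> (\<forall>p\<in>S. \<exists>U x. local_parametrization S U x \<and> p \<in> x ` U)"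

definition coord :: "(real^2 \<Rightarrow> real^'m) \<Rightarrow> 'm \<Rightarrow> real^2 \<Rightarrow> real" where
  "coord x i u = x u $ i"

definition induced_metric :: "(real^2 \<Rightarrow> real^'m) \<Rightarrow> real^2 \<Rightarrow> real^2^2" where
  "induced_metric x u =
     (\<chi> a b. \<Sum>i\<in>UNIV. partial a (coord x i) u * partial b (coord x i) u)"

definition poisson_bracket ::
    "(real^2 \<Rightarrow> real^2^2) \<Rightarrow> (real^2 \<Rightarrow> real) \<Rightarrow> (real^2 \<Rightarrow> real) \<Rightarrow> real^2 \<Rightarrow> real" where
  "poisson_bracket G f h u =
     1 / sqrt (det (G u)) *
       (partial 1 f u * partial 2 h u - partial 1 h u * partial 2 f u)"

text \<open>\<open>christoffel G c a b\<close> is \<open>\<Gamma>\<^sup>c\<^sub>a\<^sub>b\<close> of the Levi-Civita connection of \<open>G\<close>.\<close>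

definition christoffel :: "(real^2 \<Rightarrow> real^2^2) \<Rightarrow> 2 \<Rightarrow> 2 \<Rightarrow> 2 \<Rightarrow> real^2 \<Rightarrow> real" where
  "christoffel G c a b u =
     1/2 * (\<Sum>d\<in>UNIV. matrix_inv (G u) $ c $ d *
       (partial a (\<lambda>v. G v $ b $ d) u + partial b (\<lambda>v. G v $ a $ d) u
        - partial d (\<lambda>v. G v $ a $ b) u))"

text \<open>
  \<open>riemann G d c a b\<close> is \<open>R\<^sup>d\<^sub>c\<^sub>a\<^sub>b\<close>, with the convention
  \<open>R(\<partial>\<^sub>a, \<partial>\<^sub>b) \<partial>\<^sub>c = \<nabla>\<^sub>a\<nabla>\<^sub>b\<partial>\<^sub>c - \<nabla>\<^sub>b\<nabla>\<^sub>a\<partial>\<^sub>c = R\<^sup>d\<^sub>c\<^sub>a\<^sub>b \<partial>\<^sub>d\<close>. The Gaussian curvature is then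
  \<open>\<langle>R(\<partial>\<^sub>1, \<partial>\<^sub>2) \<partial>\<^sub>2, \<partial>\<^sub>1\<rangle> / det G\<close>, so that round spheres have positive curvature.
\<close>

definition riemann :: "(real^2 \<Rightarrow> real^2^2) \<Rightarrow> 2 \<Rightarrow> 2 \<Rightarrow> 2 \<Rightarrow> 2 \<Rightarrow> real^2 \<Rightarrow> real" where
  "riemann G d c a b u =
     partial a (christoffel G d b c) u - partial b (christoffel G d a c) u
     + (\<Sum>e\<in>UNIV. christoffel G d a e u * christoffel G e b c u
                   - christoffel G d b e u * christoffel G e a c u)"

definition gaussian_curvature :: "(real^2 \<Rightarrow> real^2^2) \<Rightarrow> real^2 \<Rightarrow> real" where
  "gaussian_curvature G u =
     (\<Sum>d\<in>UNIV. G u $ 1 $ d * riemann G d 2 1 2 u) / det (G u)"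

end

theory Submission
  imports Defs
begin

text \<open>
  Write \<open>e\<^sub>a = \<partial>\<^sub>a x\<close> and let \<open>n\<^sub>a\<^sub>b = \<partial>\<^sub>a\<partial>\<^sub>b x - \<Gamma>\<^sup>c\<^sub>a\<^sub>b e\<^sub>c\<close> be the vector-valued second fundamental form.
  The logarithmic derivative of \<open>\<surd>g\<close> is the trace of \<open>\<Gamma>\<close>, which cancels the tangential part of
  the derivative of \<open>{x\<^sup>j, x\<^sup>k} = (e\<^sub>1 \<and> e\<^sub>2)\<^sup>j\<^sup>k / \<surd>g\<close> and leaves
  \<open>\<partial>\<^sub>a {x\<^sup>j, x\<^sup>k} = (n\<^sub>1\<^sub>a \<and> e\<^sub>2 + e\<^sub>1 \<and> n\<^sub>a\<^sub>2)\<^sup>j\<^sup>k / \<surd>g\<close>. Hence the first sum of the theorem is half the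
  squared norm of the trace of \<open>n\<close>, the second is half the squared norm of \<open>n\<close>, and their difference is
  \<open>(n\<^sub>1\<^sub>1 \<bullet> n\<^sub>2\<^sub>2 - n\<^sub>1\<^sub>2 \<bullet> n\<^sub>1\<^sub>2) / g\<close>, which is the Gaussian curvature by the Gauss equation.
\<close>

subsection \<open>Partial derivatives and Clairaut's theorem\<close>

lemma partial_eqI:
  assumes "(f has_derivative f') (at u)"
  shows "partial a f u = f' (axis a 1)"
  unfolding partial_def using frechet_derivative_at[OF assms] by simp

text \<open>Partial derivatives are local. The identities below hold only on \<open>U\<close>, and
  this is what allows differentiating both sides of them.\<close>

lemma partial_cong:
  assumes "open U" "u \<in> U" "\<And>v. v \<in> U \<Longrightarrow> f v = g v"
  shows "partial a f u = partial a g u"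
proof -
  \<comment> \<open>\<open>frechet_derivative\<close> is a choice among derivatives, so equivalence
    of the defining predicates suffices and differentiability need not be assumed.\<close>
  have "(f has_derivative f') (at u) \<longleftrightarrow> (g has_derivative f') (at u)" for f'
    using assms has_derivative_transform_within_open[of f f' u UNIV U g]
      has_derivative_transform_within_open[of g f' u UNIV U f] by auto
  then show ?thesis
    unfolding partial_def frechet_derivative_def by simp
qed

lemma differentiable_cong:
  assumes "open U" "u \<in> U" "\<And>v. v \<in> U \<Longrightarrow> f v = g v" "g differentiable at u"
  shows "f differentiable at u"
  using assms has_derivative_transform_within_open[of g _ u UNIV U f]
  unfolding differentiable_def by metis

lemma has_derivative_partial:
  assumes "f differentiable at u"
  obtains f' where "(f has_derivative f') (at u)" "\<And>a. partial a f u = f' (axis a 1)"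
  using assms partial_eqI unfolding differentiable_def by blast

lemma partial_bounded_bilinear:
  assumes "bounded_bilinear p" "f differentiable at u" "g differentiable at u"
  shows "partial a (\<lambda>v. p (f v) (g v)) u = p (f u) (partial a g u) + p (partial a f u) (g u)"
proof -
  obtain f' where f': "(f has_derivative f') (at u)" "\<And>a. partial a f u = f' (axis a 1)"
    using has_derivative_partial[OF assms(2)] by blast
  obtain g' where g': "(g has_derivative g') (at u)" "\<And>a. partial a g u = g' (axis a 1)"
    using has_derivative_partial[OF assms(3)] by blast
  show ?thesis
    using partial_eqI[OF bounded_bilinear.FDERIV[OF assms(1) f'(1) g'(1)]] f'(2) g'(2) by simp
qed

lemmas partial_mult = partial_bounded_bilinear[OF bounded_bilinear_mult]
  and partial_inner = partial_bounded_bilinear[OF bounded_bilinear_inner]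

lemma partial_add:
  assumes "f differentiable at u" "g differentiable at u"
  shows "partial a (\<lambda>v. f v + g v) u = partial a f u + partial a g u"
  unfolding partial_def using assms
  by (subst frechet_derivative_at[symmetric]) (auto intro!: derivative_intros simp: frechet_derivative_works)

lemma partial_diff:
  assumes "f differentiable at u" "g differentiable at u"
  shows "partial a (\<lambda>v. f v - g v) u = partial a f u - partial a g u"
  unfolding partial_def using assms
  by (subst frechet_derivative_at[symmetric]) (auto intro!: derivative_intros simp: frechet_derivative_works)

lemma partial_vec_nth:
  fixes f :: "real^2 \<Rightarrow> real^'m"
  assumes "f differentiable at u"
  shows "partial a (\<lambda>v. f v $ i) u = partial a f u $ i"
proof -
  obtain f' where f': "(f has_derivative f') (at u)" "\<And>a. partial a f u = f' (axis a 1)"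
    using has_derivative_partial[OF assms] by blast
  show ?thesis
    using partial_eqI[OF bounded_linear.has_derivative[OF bounded_linear_vec_nth f'(1)]] f'(2)
    by simp
qed

lemma differentiable_vec_nth:
  fixes f :: "real^2 \<Rightarrow> real^'m"
  assumes "f differentiable F"
  shows "(\<lambda>v. f v $ i) differentiable F"
  using assms bounded_linear.has_derivative[OF bounded_linear_vec_nth]
  unfolding differentiable_def by blast

text \<open>Chain rule along a coordinate line, which reduces questions about \<open>f\<close> to
  the one-variable mean value theorem.\<close>

lemma has_derivative_along_axis:
  assumes "f differentiable at (p + s *\<^sub>R axis a 1)"
  shows "((\<lambda>s. f (p + s *\<^sub>R axis a 1)) has_derivative
    (\<lambda>t. t *\<^sub>R partial a f (p + s *\<^sub>R axis a 1))) (at s)"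
proof -
  obtain f' where f': "(f has_derivative f') (at (p + s *\<^sub>R axis a 1))"
    "\<And>b. partial b f (p + s *\<^sub>R axis a 1) = f' (axis b 1)"
    using assms has_derivative_partial by metis
  interpret f': bounded_linear f'
    using f'(1) by (rule has_derivative_bounded_linear)
  have "((\<lambda>s. p + s *\<^sub>R axis a 1) has_derivative (\<lambda>t. t *\<^sub>R axis a 1)) (at s)"
    by (auto intro!: derivative_eq_intros)
  from diff_chain_at[OF this, of f f'] f' show ?thesis
    by (simp add: o_def f'.scaleR)
qed

text \<open>Two applications of the mean value theorem, first in direction \<open>a\<close>, then in
  direction \<open>b\<close>. The second difference on the left is symmetric in \<open>a\<close> and
  \<open>b\<close>, which is the source of Clairaut's theorem.\<close>

lemma second_difference_mvt:
  fixes f :: "real^2 \<Rightarrow> real"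
  assumes "0 < h"
    and f: "\<And>s t. s \<in> {0..h} \<Longrightarrow> t \<in> {0..h} \<Longrightarrow>
      f differentiable at (p + s *\<^sub>R axis a 1 + t *\<^sub>R axis b 1)"
    and df: "\<And>s t. s \<in> {0..h} \<Longrightarrow> t \<in> {0..h} \<Longrightarrow>
      partial a f differentiable at (p + s *\<^sub>R axis a 1 + t *\<^sub>R axis b 1)"
  obtains s t where "s \<in> {0..h}" "t \<in> {0..h}"
    "f (p + h *\<^sub>R axis a 1 + h *\<^sub>R axis b 1) - f (p + h *\<^sub>R axis a 1)
      - f (p + h *\<^sub>R axis b 1) + f p
      = h\<^sup>2 * partial b (partial a f) (p + s *\<^sub>R axis a 1 + t *\<^sub>R axis b 1)"
proof -
  let ?q = "\<lambda>s t. p + s *\<^sub>R axis a 1 + t *\<^sub>R (axis b 1 :: real^2)"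
  \<comment> \<open>The second difference equals \<open>\<phi> h - \<phi> 0\<close>.\<close>
  define \<phi> where "\<phi> s = f (?q s h) - f (?q s 0)" for s
  have \<phi>': "(\<phi> has_derivative (\<lambda>r. r * (partial a f (?q s h) - partial a f (?q s 0)))) (at s)"
    if "s \<in> {0..h}" for s
  proof -
    have "((\<lambda>s. f (?q s t)) has_derivative (\<lambda>r. r * partial a f (?q s t))) (at s)"
      if "t \<in> {0..h}" for t
      using has_derivative_along_axis[of f "p + t *\<^sub>R axis b 1" s a] f[OF \<open>s \<in> _\<close> that]
      by (simp add: add_ac)
    from has_derivative_diff[OF this[of h] this[of 0]] \<open>0 < h\<close> show ?thesis
      unfolding \<phi>_def by (simp add: algebra_simps)
  qed
  have "continuous_on {0..h} \<phi>"
    using \<phi>' by (intro continuous_at_imp_continuous_on) (blast intro: has_derivative_continuous)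
  then obtain s where s: "0 < s" "s < h"
    "\<phi> h - \<phi> 0 = (h - 0) * (partial a f (?q s h) - partial a f (?q s 0))"
    using mvt[OF \<open>0 < h\<close>, of \<phi>] \<phi>' by (smt (verit) atLeastAtMost_iff)
  have \<psi>': "((\<lambda>t. partial a f (?q s t)) has_derivative
      (\<lambda>r. r * partial b (partial a f) (?q s t))) (at t)" if "t \<in> {0..h}" for t
    using has_derivative_along_axis[of "partial a f" "p + s *\<^sub>R axis a 1" t b] df[OF _ that] s by simp
  have "continuous_on {0..h} (\<lambda>t. partial a f (?q s t))"
    using \<psi>' by (intro continuous_at_imp_continuous_on) (blast intro: has_derivative_continuous)
  then obtain t where t: "0 < t" "t < h" "partial a f (?q s h) - partial a f (?q s 0)
      = (h - 0) * partial b (partial a f) (?q s t)"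
    using mvt[OF \<open>0 < h\<close>, of "\<lambda>t. partial a f (?q s t)"] \<psi>' by (smt (verit) atLeastAtMost_iff)
  show ?thesis
    using s t by (intro that[of s t]) (auto simp: \<phi>_def power2_eq_square)
qed

text \<open>Both mixed partials, each taken at some point near \<open>p\<close>, equal the same
  second difference divided by \<open>h\<close> squared. Continuity at \<open>p\<close> makes their
  values at \<open>p\<close> differ by less than any \<epsilon>.\<close>

lemma partial_commute_real:
  fixes f :: "real^2 \<Rightarrow> real"
  assumes "open U" "p \<in> U"
    and f: "\<And>v. v \<in> U \<Longrightarrow> f differentiable at v"
    and df: "\<And>v c. v \<in> U \<Longrightarrow> partial c f differentiable at v"
    and ddf: "\<And>c d. continuous_on U (partial c (partial d f))"
  shows "partial a (partial b f) p = partial b (partial a f) p"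
proof -
  have "\<bar>partial a (partial b f) p - partial b (partial a f) p\<bar> < \<epsilon>" if "\<epsilon> > 0" for \<epsilon>
  proof -
    have "\<exists>\<delta>>0. \<forall>v. dist v p < \<delta> \<longrightarrow>
        \<bar>partial c (partial d f) v - partial c (partial d f) p\<bar> < \<epsilon> / 2" for c d
    proof -
      have "isCont (partial c (partial d f)) p"
        using ddf \<open>open U\<close> \<open>p \<in> U\<close> continuous_on_eq_continuous_at by blast
      then show ?thesis
        using \<open>\<epsilon> > 0\<close> unfolding continuous_at_eps_delta dist_real_def by (metis half_gt_zero)
    qed
    then obtain \<delta>1 \<delta>2 where \<delta>: "\<delta>1 > 0" "\<delta>2 > 0"
      "\<And>v. dist v p < \<delta>1 \<Longrightarrow> \<bar>partial a (partial b f) v - partial a (partial b f) p\<bar> < \<epsilon> / 2"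
      "\<And>v. dist v p < \<delta>2 \<Longrightarrow> \<bar>partial b (partial a f) v - partial b (partial a f) p\<bar> < \<epsilon> / 2"
      by metis
    obtain \<delta>3 where \<delta>3: "\<delta>3 > 0" "ball p \<delta>3 \<subseteq> U"
      using \<open>open U\<close> \<open>p \<in> U\<close> open_contains_ball by blast
    \<comment> \<open>The corner points used lie within \<open>2 * h\<close> of \<open>p\<close>,
      hence strictly within \<open>3 * h\<close>, which is at most each of the three radii.\<close>
    define h where "h = Min {\<delta>1, \<delta>2, \<delta>3} / 3"
    have h: "0 < h" "3 * h \<le> \<delta>1" "3 * h \<le> \<delta>2" "3 * h \<le> \<delta>3"
      using \<delta> \<delta>3 by (auto simp: h_def)
    have near: "dist (p + s *\<^sub>R axis c 1 + t *\<^sub>R axis d 1) p < 3 * h"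
      if "s \<in> {0..h}" "t \<in> {0..h}" for s t c d
    proof -
      have "dist (p + s *\<^sub>R axis c 1 + t *\<^sub>R axis d 1) p
          = norm (s *\<^sub>R axis c 1 + t *\<^sub>R (axis d 1 :: real^2))"
        by (simp add: dist_norm)
      also have "\<dots> \<le> \<bar>s\<bar> + \<bar>t\<bar>"
        by (rule norm_triangle_le) (simp add: norm_axis_1)
      finally show ?thesis
        using that h(1) by simp
    qed
    have inU: "p + s *\<^sub>R axis c 1 + t *\<^sub>R axis d 1 \<in> U"
      if "s \<in> {0..h}" "t \<in> {0..h}" for s t c d
    proof -
      have "p + s *\<^sub>R axis c 1 + t *\<^sub>R axis d 1 \<in> ball p \<delta>3"
        using near[OF that, of c d] h(4) by (simp only: mem_ball dist_commute)
      then show ?thesis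
        using \<delta>3(2) by blast
    qed
    obtain s t where st: "s \<in> {0..h}" "t \<in> {0..h}"
      "f (p + h *\<^sub>R axis a 1 + h *\<^sub>R axis b 1) - f (p + h *\<^sub>R axis a 1)
        - f (p + h *\<^sub>R axis b 1) + f p
        = h\<^sup>2 * partial b (partial a f) (p + s *\<^sub>R axis a 1 + t *\<^sub>R axis b 1)"
      using second_difference_mvt[OF h(1), of f p a b] f df inU by blast
    obtain s' t' where st': "s' \<in> {0..h}" "t' \<in> {0..h}"
      "f (p + h *\<^sub>R axis b 1 + h *\<^sub>R axis a 1) - f (p + h *\<^sub>R axis b 1)
        - f (p + h *\<^sub>R axis a 1) + f p
        = h\<^sup>2 * partial a (partial b f) (p + s' *\<^sub>R axis b 1 + t' *\<^sub>R axis a 1)"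
      using second_difference_mvt[OF h(1), of f p b a] f df inU by blast
    have "h\<^sup>2 * partial b (partial a f) (p + s *\<^sub>R axis a 1 + t *\<^sub>R axis b 1)
        = h\<^sup>2 * partial a (partial b f) (p + s' *\<^sub>R axis b 1 + t' *\<^sub>R axis a 1)"
      unfolding st(3)[symmetric] st'(3)[symmetric] by (simp add: add_ac)
    then have "partial b (partial a f) (p + s *\<^sub>R axis a 1 + t *\<^sub>R axis b 1)
        = partial a (partial b f) (p + s' *\<^sub>R axis b 1 + t' *\<^sub>R axis a 1)"
      using h(1) by simp
    moreover have "dist (p + s *\<^sub>R axis a 1 + t *\<^sub>R axis b 1) p < \<delta>2"
      "dist (p + s' *\<^sub>R axis b 1 + t' *\<^sub>R axis a 1) p < \<delta>1"
      using near[OF st(1,2), of a b] near[OF st'(1,2), of b a] h by linarith+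
    ultimately show ?thesis
      using \<delta>(3,4) by (smt (verit) field_sum_of_halves)
  qed
  then show ?thesis
    by (metis abs_le_zero_iff eq_iff_diff_eq_0 less_irrefl not_less zero_less_abs_iff)
qed

lemma partial_commute:
  fixes f :: "real^2 \<Rightarrow> real^'m"
  assumes "open U" "p \<in> U"
    and f: "\<And>v. v \<in> U \<Longrightarrow> f differentiable at v"
    and df: "\<And>v c. v \<in> U \<Longrightarrow> partial c f differentiable at v"
    and ddf: "\<And>c d. continuous_on U (partial c (partial d f))"
  shows "partial a (partial b f) p = partial b (partial a f) p"
proof -
  have 1: "partial c (\<lambda>v. f v $ i) v = partial c f v $ i" if "v \<in> U" for c v i
    using partial_vec_nth f that by blast
  have 2: "partial d (partial c (\<lambda>v. f v $ i)) v = partial d (partial c f) v $ i" if "v \<in> U" for c d v i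
  proof -
    have "partial d (partial c (\<lambda>v. f v $ i)) v = partial d (\<lambda>v. partial c f v $ i) v"
      by (rule partial_cong[OF \<open>open U\<close> that 1])
    also have "\<dots> = partial d (partial c f) v $ i"
      by (rule partial_vec_nth[OF df[OF that]])
    finally show ?thesis .
  qed
  have "partial a (partial b (\<lambda>v. f v $ i)) p = partial b (partial a (\<lambda>v. f v $ i)) p" for i
  proof (rule partial_commute_real[OF assms(1,2)])
    show "partial c (\<lambda>v. f v $ i) differentiable at v" if "v \<in> U" for c v
      by (rule differentiable_cong[OF \<open>open U\<close> that 1 differentiable_vec_nth[OF df[OF that]]])
    show "continuous_on U (partial c (partial d (\<lambda>v. f v $ i)))" for c d
      using continuous_on_component[OF ddf] by (subst continuous_on_cong[OF refl 2]) auto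
  qed (use f differentiable_vec_nth in blast)
  then show ?thesis
    using 2 \<open>p \<in> U\<close> by (simp add: vec_eq_iff)
qed

lemma smooth_on_differentiable:
  "smooth_on U f \<Longrightarrow> u \<in> U \<Longrightarrow> f differentiable at u"
  unfolding smooth_on_def by (metis Ck_on.simps(2))

lemma smooth_on_continuous_on: "smooth_on U f \<Longrightarrow> continuous_on U f"
  unfolding smooth_on_def by (metis Ck_on.simps(1))

lemma smooth_on_partial: "smooth_on U f \<Longrightarrow> smooth_on U (partial a f)"
  unfolding smooth_on_def by (metis Ck_on.simps(2))

lemma smooth_on_partial_commute:
  fixes f :: "real^2 \<Rightarrow> real^'m"
  assumes "open U" "smooth_on U f" "u \<in> U"
  shows "partial a (partial b f) u = partial b (partial a f) u"
  using assms by (intro partial_commute[of U])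
    (auto intro: smooth_on_differentiable smooth_on_continuous_on smooth_on_partial)

subsection \<open>Linear algebra\<close>

text \<open>\<open>matrix_inv\<close> is defined by choice; uniqueness of two-sided inverses
  identifies its value.\<close>

lemma matrix_inv_unique:
  fixes A B :: "'a::semiring_1^'n^'n"
  assumes "A ** B = mat 1" "B ** A = mat 1"
  shows "matrix_inv A = B"
proof -
  have "matrix_inv A ** A = mat 1"
    unfolding matrix_inv_def by (rule someI2[of _ B]) (use assms in auto)
  then show ?thesis
    using assms(1) by (metis matrix_mul_assoc matrix_mul_lid matrix_mul_rid)
qed

lemma matrix_inv_2:
  fixes A :: "'a::field^2^2"
  assumes "det A \<noteq> 0"
  shows "matrix_inv A = (\<chi> i j. (if i = 1 then if j = 1 then A $ 2 $ 2 else - A $ 1 $ 2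
    else if j = 1 then - A $ 2 $ 1 else A $ 1 $ 1) / det A)" (is "_ = ?B")
proof (rule matrix_inv_unique)
  have "A $ 1 $ 1 * A $ 2 $ 2 - A $ 1 $ 2 * A $ 2 $ 1 = det A"
    by (simp add: det_2)
  then show "A ** ?B = mat 1" "?B ** A = mat 1"
    using assms
    by (simp_all add: vec_eq_iff forall_2 matrix_matrix_mult_def sum_2 mat_def field_simps)
qed

section \<open>Bivectors and the algebra of the second fundamental form\<close>

definition wedge :: "real^'m \<Rightarrow> real^'m \<Rightarrow> 'm \<Rightarrow> 'm \<Rightarrow> real" where
  "wedge a b j k = a $ j * b $ k - a $ k * b $ j"

text \<open>The Binet-Cauchy identity for the components of simple bivectors. The factor 2 arises
  because every pair of indices is summed in both orders.\<close>

lemma wedge_inner: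
  "(\<Sum>j\<in>UNIV. \<Sum>k\<in>UNIV. wedge a b j k * wedge c d j k)
    = 2 * ((a \<bullet> c) * (b \<bullet> d) - (a \<bullet> d) * (b \<bullet> c))"
proof -
  have *: "(p \<bullet> q) * (r \<bullet> t) = (\<Sum>j\<in>UNIV. \<Sum>k\<in>UNIV. (p $ j * q $ j) * (r $ k * t $ k))"
    for p q r t :: "real^'m"
    by (simp add: inner_vec_def sum_product)
  have "(a \<bullet> c) * (b \<bullet> d) + (b \<bullet> d) * (a \<bullet> c) - (a \<bullet> d) * (b \<bullet> c) - (b \<bullet> c) * (a \<bullet> d)
      = (\<Sum>j\<in>UNIV. \<Sum>k\<in>UNIV. wedge a b j k * wedge c d j k)"
    unfolding * wedge_def sum.distrib[symmetric] sum_subtractf[symmetric]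
    by (intro sum.cong refl) (simp add: algebra_simps)
  then show ?thesis
    by (simp add: algebra_simps)
qed

lemma wedge_contract:
  "(\<Sum>k\<in>UNIV. wedge a b j k * c $ k) = a $ j * (b \<bullet> c) - b $ j * (a \<bullet> c)"
  unfolding inner_vec_def wedge_def sum_distrib_left sum_subtractf[symmetric]
  by (intro sum.cong refl) (simp add: algebra_simps)

text \<open>The purely algebraic core, at a single point. \<open>T j k l\<close> stands for the
  iterated bracket, \<open>N1\<close> and \<open>N2\<close> for the derivatives of the inner bracket
  up to the factor of the root of \<open>D\<close>, and \<open>D\<close> for the Gram determinant of
  the tangent vectors.\<close>

lemma second_form_identity:
  fixes e1 e2 n11 n12 n22 :: "real^'m"
  defines "N1 \<equiv> \<lambda>j k. wedge n11 e2 j k + wedge e1 n12 j k"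
    and "N2 \<equiv> \<lambda>j k. wedge n12 e2 j k + wedge e1 n22 j k"
    and "D \<equiv> (e1 \<bullet> e1) * (e2 \<bullet> e2) - (e1 \<bullet> e2)\<^sup>2"
  assumes D: "D \<noteq> 0"
    and orth: "n11 \<bullet> e1 = 0" "n11 \<bullet> e2 = 0" "n12 \<bullet> e1 = 0" "n12 \<bullet> e2 = 0"
      "n22 \<bullet> e1 = 0" "n22 \<bullet> e2 = 0"
    and T: "\<And>j k l. T j k l = (N1 j k * e2 $ l - N2 j k * e1 $ l) / D"
  shows "(\<Sum>j\<in>UNIV. \<Sum>k\<in>UNIV. \<Sum>l\<in>UNIV. 1/2 * T j k k * T j l l - 1/4 * T j k l * T j k l)
    = (n11 \<bullet> n22 - n12 \<bullet> n12) / D"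
proof -
  note orth' = orth orth[unfolded inner_commute[of _ e1] inner_commute[of _ e2]]
  \<comment> \<open>\<open>H\<close> is \<open>D\<close> times the trace of the second fundamental
    form with respect to the inverse metric.\<close>
  define H where "H = (e2 \<bullet> e2) *\<^sub>R n11 - (2 * (e1 \<bullet> e2)) *\<^sub>R n12 + (e1 \<bullet> e1) *\<^sub>R n22"
  have trace: "(\<Sum>k\<in>UNIV. T j k k) = H $ j / D" for j
  proof -
    have "(\<Sum>k\<in>UNIV. T j k k) =
      ((\<Sum>k\<in>UNIV. wedge n11 e2 j k * e2 $ k) + (\<Sum>k\<in>UNIV. wedge e1 n12 j k * e2 $ k)
        - (\<Sum>k\<in>UNIV. wedge n12 e2 j k * e1 $ k) - (\<Sum>k\<in>UNIV. wedge e1 n22 j k * e1 $ k)) / D"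
      unfolding T N1_def N2_def sum.distrib[symmetric] sum_subtractf[symmetric] sum_divide_distrib
      by (intro sum.cong refl) (simp add: algebra_simps)
    also have "\<dots> = H $ j / D"
      \<comment> \<open>Normality kills the contractions of each \<open>n\<close> with a tangent
        vector, so no multiple of \<open>e1\<close> or \<open>e2\<close> survives.\<close>
      unfolding wedge_contract using orth' by (simp add: H_def inner_commute algebra_simps)
    finally show ?thesis .
  qed
  have "(\<Sum>j\<in>UNIV. \<Sum>k\<in>UNIV. \<Sum>l\<in>UNIV. T j k k * T j l l) = (\<Sum>j\<in>UNIV. (H $ j / D) * (H $ j / D))"
    by (simp only: trace sum_product[symmetric])
  also have "\<dots> = (H \<bullet> H) / D\<^sup>2"
    by (simp add: inner_vec_def sum_divide_distrib power2_eq_square)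
  finally have first: "(\<Sum>j\<in>UNIV. \<Sum>k\<in>UNIV. \<Sum>l\<in>UNIV. T j k k * T j l l) = (H \<bullet> H) / D\<^sup>2" .
  have sq: "(\<Sum>l\<in>UNIV. T j k l * T j k l) = ((e2 \<bullet> e2) * (N1 j k * N1 j k)
      - 2 * (e1 \<bullet> e2) * (N1 j k * N2 j k) + (e1 \<bullet> e1) * (N2 j k * N2 j k)) / D\<^sup>2" for j k
  proof -
    have "T j k l * T j k l = (N1 j k * N1 j k * (e2 $ l * e2 $ l)
        - 2 * (N1 j k * N2 j k) * (e1 $ l * e2 $ l) + N2 j k * N2 j k * (e1 $ l * e1 $ l)) / D\<^sup>2" for l
      unfolding T power2_eq_square times_divide_times_eq
      by (rule arg_cong[of _ _ "\<lambda>y. y / (D * D)"]) (simp add: algebra_simps)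
    then show ?thesis
      by (simp only: sum_divide_distrib[symmetric] sum.distrib sum_subtractf sum_distrib_left[symmetric]
          inner_vec_def inner_real_def) (simp add: mult_ac)
  qed
  \<comment> \<open>Polarized form covering all three sums of products of \<open>N1\<close> and
    \<open>N2\<close>; the mixed wedge products contribute only through
    \<open>e1 \<bullet> e2\<close>.\<close>
  have N: "(\<Sum>j\<in>UNIV. \<Sum>k\<in>UNIV. (wedge a e2 j k + wedge e1 b j k) * (wedge c e2 j k + wedge e1 d j k))
      = 2 * ((e2 \<bullet> e2) * (a \<bullet> c) - (e1 \<bullet> e2) * (a \<bullet> d + b \<bullet> c) + (e1 \<bullet> e1) * (b \<bullet> d))"
    if "a \<bullet> e1 = 0" "a \<bullet> e2 = 0" "b \<bullet> e1 = 0" "b \<bullet> e2 = 0"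
      "c \<bullet> e1 = 0" "c \<bullet> e2 = 0" "d \<bullet> e1 = 0" "d \<bullet> e2 = 0" for a b c d :: "real^'m"
  proof -
    have "(\<Sum>j\<in>UNIV. \<Sum>k\<in>UNIV. (wedge a e2 j k + wedge e1 b j k) * (wedge c e2 j k + wedge e1 d j k))
      = (\<Sum>j\<in>UNIV. \<Sum>k\<in>UNIV. wedge a e2 j k * wedge c e2 j k)
      + (\<Sum>j\<in>UNIV. \<Sum>k\<in>UNIV. wedge a e2 j k * wedge e1 d j k)
      + (\<Sum>j\<in>UNIV. \<Sum>k\<in>UNIV. wedge e1 b j k * wedge c e2 j k)
      + (\<Sum>j\<in>UNIV. \<Sum>k\<in>UNIV. wedge e1 b j k * wedge e1 d j k)"
      by (simp add: sum.distrib[symmetric] algebra_simps)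
    then show ?thesis
      unfolding wedge_inner using that by (simp add: inner_commute algebra_simps)
  qed
  have "(\<Sum>j\<in>UNIV. \<Sum>k\<in>UNIV. \<Sum>l\<in>UNIV. T j k l * T j k l) =
      ((e2 \<bullet> e2) * (\<Sum>j\<in>UNIV. \<Sum>k\<in>UNIV. N1 j k * N1 j k)
      - 2 * (e1 \<bullet> e2) * (\<Sum>j\<in>UNIV. \<Sum>k\<in>UNIV. N1 j k * N2 j k)
      + (e1 \<bullet> e1) * (\<Sum>j\<in>UNIV. \<Sum>k\<in>UNIV. N2 j k * N2 j k)) / D\<^sup>2"
    unfolding sq sum_distrib_left sum.distrib[symmetric] sum_subtractf[symmetric] sum_divide_distrib
    by simp
  also have "\<dots> = ((e2 \<bullet> e2) * (2 * ((e2 \<bullet> e2) * (n11 \<bullet> n11) - (e1 \<bullet> e2) * (n11 \<bullet> n12 + n12 \<bullet> n11)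
          + (e1 \<bullet> e1) * (n12 \<bullet> n12)))
      - 2 * (e1 \<bullet> e2) * (2 * ((e2 \<bullet> e2) * (n11 \<bullet> n12) - (e1 \<bullet> e2) * (n11 \<bullet> n22 + n12 \<bullet> n12)
          + (e1 \<bullet> e1) * (n12 \<bullet> n22)))
      + (e1 \<bullet> e1) * (2 * ((e2 \<bullet> e2) * (n12 \<bullet> n12) - (e1 \<bullet> e2) * (n12 \<bullet> n22 + n22 \<bullet> n12)
          + (e1 \<bullet> e1) * (n22 \<bullet> n22)))) / D\<^sup>2" (is "_ = ?S / D\<^sup>2")
    unfolding N1_def N2_def by (simp only: N orth)
  finally have second: "(\<Sum>j\<in>UNIV. \<Sum>k\<in>UNIV. \<Sum>l\<in>UNIV. T j k l * T j k l) = ?S / D\<^sup>2" .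
  have "(\<Sum>j\<in>UNIV. \<Sum>k\<in>UNIV. \<Sum>l\<in>UNIV. 1/2 * T j k k * T j l l - 1/4 * T j k l * T j k l)
      = 1/2 * (\<Sum>j\<in>UNIV. \<Sum>k\<in>UNIV. \<Sum>l\<in>UNIV. T j k k * T j l l)
        - 1/4 * (\<Sum>j\<in>UNIV. \<Sum>k\<in>UNIV. \<Sum>l\<in>UNIV. T j k l * T j k l)"
    by (simp only: sum_subtractf sum_distrib_left mult.assoc)
  also have "\<dots> = (1/2 * (H \<bullet> H) - 1/4 * ?S) / D\<^sup>2"
    unfolding first second by (simp add: diff_divide_distrib)
  also have "1/2 * (H \<bullet> H) - 1/4 * ?S = D * (n11 \<bullet> n22 - n12 \<bullet> n12)"
  proof -
    \<comment> \<open>Here \<open>E\<close>, \<open>F\<close>, \<open>G\<close> are the metric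
      coefficients, and \<open>a\<close> to \<open>f\<close> are the inner products 11.11, 11.12,
      11.22, 12.12, 12.22, 22.22 of the normal vectors.\<close>
    have ring: "1/2 * (G*G*a + 4*F*F*d + E*E*f - 4*G*F*b + 2*G*E*c - 4*F*E*e)
        - 1/4 * (G * (2 * (G*a - F*(b+b) + E*d)) - 2*F * (2*(G*b - F*(c+d) + E*e))
          + E * (2*(G*d - F*(e+e) + E*f))) = (E*G - F\<^sup>2) * (c - d)" for E F G a b c d e f :: real
      by (simp add: algebra_simps power2_eq_square)
    have "H \<bullet> H = (e2 \<bullet> e2)*(e2 \<bullet> e2)*(n11 \<bullet> n11) + 4*(e1 \<bullet> e2)*(e1 \<bullet> e2)*(n12 \<bullet> n12)
        + (e1 \<bullet> e1)*(e1 \<bullet> e1)*(n22 \<bullet> n22) - 4*(e2 \<bullet> e2)*(e1 \<bullet> e2)*(n11 \<bullet> n12)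
        + 2*(e2 \<bullet> e2)*(e1 \<bullet> e1)*(n11 \<bullet> n22) - 4*(e1 \<bullet> e2)*(e1 \<bullet> e1)*(n12 \<bullet> n22)"
      unfolding H_def by (simp add: inner_add_left inner_add_right inner_diff_left inner_diff_right
        inner_commute[of n22 n11] inner_commute[of n12 n11] inner_commute[of n22 n12] algebra_simps)
    then show ?thesis
      unfolding D_def by (simp only: ring inner_commute[of n22 n11] inner_commute[of n12 n11] inner_commute[of n22 n12])
  qed
  finally show ?thesis
    using D by (simp add: power2_eq_square)
qed

subsection \<open>Immersed surface patches\<close>

locale immersion =
  fixes U :: "(real^2) set" and x :: "real^2 \<Rightarrow> real^'m"
  assumes open_U: "open U" and smooth: "smooth_on U x"
    and inj: "\<And>u. u \<in> U \<Longrightarrow> inj (frechet_derivative x (at u))"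
begin

abbreviation e :: "2 \<Rightarrow> real^2 \<Rightarrow> real^'m" where
  "e a \<equiv> partial a x"

abbreviation h :: "2 \<Rightarrow> 2 \<Rightarrow> real^2 \<Rightarrow> real^'m" where
  "h a b \<equiv> partial a (partial b x)"

abbreviation g :: "2 \<Rightarrow> 2 \<Rightarrow> real^2 \<Rightarrow> real" where
  "g a b v \<equiv> e a v \<bullet> e b v"

definition detg :: "real^2 \<Rightarrow> real" where
  "detg v = g 1 1 v * g 2 2 v - (g 1 2 v)\<^sup>2"

text \<open>
  The Christoffel symbols with the inverse metric written out. The Gauss equation is derived from
  the lowered relation \<open>\<Gamma>_lower\<close>, so that the inverse metric never has to be differentiated.
\<close>

definition \<Gamma> :: "2 \<Rightarrow> 2 \<Rightarrow> 2 \<Rightarrow> real^2 \<Rightarrow> real" where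
  "\<Gamma> c a b v =
    (if c = 1 then g 2 2 v * (h a b v \<bullet> e 1 v) - g 1 2 v * (h a b v \<bullet> e 2 v)
     else g 1 1 v * (h a b v \<bullet> e 2 v) - g 1 2 v * (h a b v \<bullet> e 1 v)) / detg v"

definition n :: "2 \<Rightarrow> 2 \<Rightarrow> real^2 \<Rightarrow> real^'m" where
  "n a b v = h a b v - \<Gamma> 1 a b v *\<^sub>R e 1 v - \<Gamma> 2 a b v *\<^sub>R e 2 v"

lemma differentiable:
  assumes "v \<in> U"
  shows "x differentiable at v" "e a differentiable at v" "h a b differentiable at v"
  using assms smooth by (auto intro: smooth_on_differentiable smooth_on_partial)

lemma h_commute: "v \<in> U \<Longrightarrow> h a b v = h b a v"
  using smooth_on_partial_commute[OF open_U smooth] .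

lemma partial_h_commute:
  assumes "v \<in> U"
  shows "partial a (h b c) v = partial b (h a c) v"
  using smooth_on_partial_commute[OF open_U smooth_on_partial[OF smooth] assms] .

text \<open>The Gram determinant of linearly independent vectors is positive; independence comes
  from the injective differential.\<close>

lemma detg_pos:
  assumes "v \<in> U"
  shows "detg v > 0"
proof -
  let ?x' = "frechet_derivative x (at v)"
  interpret x': linear ?x'
    using differentiable(1)[OF assms] by (rule linear_frechet_derivative)
  have indep: "r = 0 \<and> s = 0" if "r *\<^sub>R e 1 v + s *\<^sub>R e 2 v = 0" for r s
  proof -
    have "?x' (r *\<^sub>R axis 1 1 + s *\<^sub>R axis 2 1) = ?x' 0"
      using that by (simp add: x'.add x'.scale partial_def x'.zero)
    then have "r *\<^sub>R axis 1 1 + s *\<^sub>R axis 2 1 = (0::real^2)"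
      by (rule injD[OF inj[OF assms]])
    then show ?thesis
      by (simp add: vec_eq_iff forall_2 axis_def)
  qed
  have e2: "e 2 v \<noteq> 0"
    using indep[of 0 1] by auto
  \<comment> \<open>\<open>y\<close> is \<open>g 2 2 v\<close> times the component of
    \<open>e 1 v\<close> orthogonal to \<open>e 2 v\<close>, so its squared norm contains the Gram
    determinant as a factor.\<close>
  define y where "y = g 2 2 v *\<^sub>R e 1 v + (- g 1 2 v) *\<^sub>R e 2 v"
  have "y \<noteq> 0"
    using indep[of "g 2 2 v" "- g 1 2 v"] e2 unfolding y_def by auto
  then have "0 < y \<bullet> y"
    by simp
  also have "y \<bullet> y = g 2 2 v * detg v"
    unfolding y_def detg_def
    by (simp add: inner_add_left inner_add_right inner_diff_left inner_diff_right
        inner_commute[of "e 2 v" "e 1 v"] power2_eq_square algebra_simps)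
  finally show ?thesis
    using e2 by (metis inner_gt_zero_iff zero_less_mult_pos)
qed

text \<open>Cramer's rule: \<Gamma> solves the linear system whose matrix is the metric.
  Equivalently, its entries are the coefficients of the tangential part of
  \<open>h a b v\<close>.\<close>

lemma \<Gamma>_lower:
  assumes "v \<in> U"
  shows "g 1 d v * \<Gamma> 1 a b v + g 2 d v * \<Gamma> 2 a b v = h a b v \<bullet> e d v"
proof -
  have D: "detg v \<noteq> 0"
    using detg_pos[OF assms] by simp
  have "(g 1 d v * \<Gamma> 1 a b v + g 2 d v * \<Gamma> 2 a b v) * detg v = (h a b v \<bullet> e d v) * detg v"
  proof (cases "d = 1")
    case True
    then show ?thesis
      using D by (simp add: \<Gamma>_def distrib_right) (simp add: detg_def inner_commute[of "e 2 v" "e 1 v"]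
        power2_eq_square algebra_simps)
  next
    case False
    then have "d = 2"
      using exhaust_2 by blast
    then show ?thesis
      using D by (simp add: \<Gamma>_def distrib_right) (simp add: detg_def inner_commute[of "e 2 v" "e 1 v"]
        power2_eq_square algebra_simps)
  qed
  then show ?thesis
    using D by simp
qed

lemma n_orthogonal: "v \<in> U \<Longrightarrow> n a b v \<bullet> e d v = 0"
  using \<Gamma>_lower[of v d a b] unfolding n_def by (simp add: inner_diff_left mult.commute)

lemma \<Gamma>_commute: "v \<in> U \<Longrightarrow> \<Gamma> c a b v = \<Gamma> c b a v"
  unfolding \<Gamma>_def by (simp add: h_commute[of v a b])

lemma partial_g:
  assumes "v \<in> U"
  shows "partial c (g a b) v = e a v \<bullet> h c b v + h c a v \<bullet> e b v"
  using assms by (intro partial_inner differentiable)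

section \<open>The induced metric, its Christoffel symbols and the Gauss equation\<close>

lemma coord_partial: "v \<in> U \<Longrightarrow> partial a (coord x i) v = e a v $ i"
  unfolding coord_def by (rule partial_vec_nth[OF differentiable(1)])

lemma induced_metric_eq: "v \<in> U \<Longrightarrow> induced_metric x v $ a $ b = g a b v"
  unfolding induced_metric_def by (simp add: coord_partial inner_vec_def)

lemma det_induced_metric: "v \<in> U \<Longrightarrow> det (induced_metric x v) = detg v"
  by (simp add: det_2 induced_metric_eq detg_def power2_eq_square inner_commute)

lemma partial_induced_metric:
  assumes "v \<in> U"
  shows "partial c (\<lambda>w. induced_metric x w $ a $ b) v = e a v \<bullet> h c b v + h c a v \<bullet> e b v"
  using partial_cong[OF open_U assms induced_metric_eq] partial_g[OF assms] by simp

text \<open>Each metric derivative has two terms of type \<open>e \<bullet> h\<close>. By symmetry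
  of \<open>h\<close>, four of the six cancel and the other two coincide.\<close>

lemma christoffel_induced_metric:
  assumes "v \<in> U"
  shows "christoffel (induced_metric x) c a b v = \<Gamma> c a b v"
proof -
  have D: "det (induced_metric x v) \<noteq> 0"
    using detg_pos[OF assms] det_induced_metric[OF assms] by simp
  have first_kind: "partial a (\<lambda>v. induced_metric x v $ b $ d) v + partial b (\<lambda>v. induced_metric x v $ a $ d) v
      - partial d (\<lambda>v. induced_metric x v $ a $ b) v = 2 * (h a b v \<bullet> e d v)" for d
    unfolding partial_induced_metric[OF assms]
    using h_commute[OF assms, of b a] h_commute[OF assms, of a d] h_commute[OF assms, of b d]
    by (simp add: inner_commute)
  show ?thesis
    unfolding christoffel_def first_kind matrix_inv_2[OF D] \<Gamma>_def
    using det_induced_metric[OF assms] induced_metric_eq[OF assms]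
    by (cases "c = 1") (auto simp: sum_2 inner_commute diff_divide_distrib)
qed

lemma differentiable_detg: "v \<in> U \<Longrightarrow> detg differentiable at v"
  unfolding detg_def[abs_def]
  by (intro derivative_intros differentiable differentiable_inner)

lemma differentiable_\<Gamma>:
  assumes "v \<in> U"
  shows "\<Gamma> c a b differentiable at v"
proof -
  have "detg v \<noteq> 0"
    using detg_pos[OF assms] by simp
  with assms show ?thesis
    unfolding \<Gamma>_def[abs_def]
    by (cases "c = 1") (auto intro!: derivative_intros differentiable differentiable_inner
        differentiable_divide differentiable_detg)
qed

text \<open>The product rule applied to both sides of \<open>\<Gamma>_lower\<close>, with the
  derivatives of the metric moved to the right.\<close>

lemma partial_\<Gamma>_lower:
  assumes "v \<in> U"
  shows "g 1 d v * partial c (\<Gamma> 1 a b) v + g 2 d v * partial c (\<Gamma> 2 a b) v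
    = partial c (h a b) v \<bullet> e d v + h a b v \<bullet> h c d v
      - (e 1 v \<bullet> h c d v + h c 1 v \<bullet> e d v) * \<Gamma> 1 a b v
      - (e 2 v \<bullet> h c d v + h c 2 v \<bullet> e d v) * \<Gamma> 2 a b v"
proof -
  have dg: "(\<lambda>v. g i j v) differentiable at v" for i j
    using assms by (intro differentiable differentiable_inner)
  have "partial c (\<lambda>v. g 1 d v * \<Gamma> 1 a b v + g 2 d v * \<Gamma> 2 a b v) v
      = partial c (\<lambda>v. h a b v \<bullet> e d v) v"
    by (rule partial_cong[OF open_U assms \<Gamma>_lower])
  then show ?thesis
    using assms differentiable(2,3)[OF assms]
    by (simp add: partial_add partial_mult partial_inner partial_g dg differentiable_\<Gamma> differentiable_mult
       algebra_simps)
qed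

text \<open>The curvature with its upper index lowered involves \<Gamma> and its derivatives only in
  combinations governed by \<open>\<Gamma>_lower\<close> and
  \<open>partial_\<Gamma>_lower\<close>.\<close>

lemma gauss_equation:
  assumes "u \<in> U"
  shows "gaussian_curvature (induced_metric x) u = (n 1 1 u \<bullet> n 2 2 u - n 1 2 u \<bullet> n 1 2 u) / detg u"
proof -
  have riemann: "riemann (induced_metric x) d c a b u = partial a (\<Gamma> d b c) u - partial b (\<Gamma> d a c) u
      + (\<Gamma> d a 1 u * \<Gamma> 1 b c u - \<Gamma> d b 1 u * \<Gamma> 1 a c u)
      + (\<Gamma> d a 2 u * \<Gamma> 2 b c u - \<Gamma> d b 2 u * \<Gamma> 2 a c u)" for a b c d
    unfolding riemann_def
    by (simp add: sum_2 christoffel_induced_metric[OF assms]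
      partial_cong[OF open_U assms christoffel_induced_metric])
  have "g 1 1 u * riemann (induced_metric x) 1 2 1 2 u + g 2 1 u * riemann (induced_metric x) 2 2 1 2 u
      = (g 1 1 u * partial 1 (\<Gamma> 1 2 2) u + g 2 1 u * partial 1 (\<Gamma> 2 2 2) u)
      - (g 1 1 u * partial 2 (\<Gamma> 1 1 2) u + g 2 1 u * partial 2 (\<Gamma> 2 1 2) u)
      + (g 1 1 u * \<Gamma> 1 1 1 u + g 2 1 u * \<Gamma> 2 1 1 u) * \<Gamma> 1 2 2 u
      - (g 1 1 u * \<Gamma> 1 2 1 u + g 2 1 u * \<Gamma> 2 2 1 u) * \<Gamma> 1 1 2 u
      + (g 1 1 u * \<Gamma> 1 1 2 u + g 2 1 u * \<Gamma> 2 1 2 u) * \<Gamma> 2 2 2 u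
      - (g 1 1 u * \<Gamma> 1 2 2 u + g 2 1 u * \<Gamma> 2 2 2 u) * \<Gamma> 2 1 2 u"
    unfolding riemann by (simp add: algebra_simps)
  \<comment> \<open>The third derivatives of \<open>x\<close> cancel because partial derivatives of
    \<open>e 2\<close> commute.\<close>
  also have "\<dots> = h 1 1 u \<bullet> n 2 2 u - h 1 2 u \<bullet> n 1 2 u"
    unfolding \<Gamma>_lower[OF assms] partial_\<Gamma>_lower[OF assms] n_def partial_h_commute[OF assms, of 2 1]
      h_commute[OF assms, of 2 1]
    by (simp add: inner_diff_right inner_commute[of "e _ u" "h _ _ u"] inner_commute[of "h 2 2 u" "h 1 1 u"]
      algebra_simps)
  also have "\<dots> = n 1 1 u \<bullet> n 2 2 u - n 1 2 u \<bullet> n 1 2 u"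
  proof -
    \<comment> \<open>The tangential part of \<open>h\<close> is orthogonal to the normal vector
      \<open>n\<close>.\<close>
    have "h a b u \<bullet> n c d u = n a b u \<bullet> n c d u" for a b c d
      using n_orthogonal[OF assms] unfolding n_def[of a b]
      by (simp add: inner_diff_left inner_commute[of "e _ u" "n _ _ u"])
    then show ?thesis
      by simp
  qed
  finally show ?thesis
    unfolding gaussian_curvature_def
    by (simp add: sum_2 induced_metric_eq[OF assms] det_induced_metric[OF assms]
      inner_commute[of "e 2 u" "e 1 u"])
qed


section \<open>Poisson brackets of the embedding coordinates\<close>

abbreviation bracket :: "(real^2 \<Rightarrow> real) \<Rightarrow> (real^2 \<Rightarrow> real) \<Rightarrow> real^2 \<Rightarrow> real" where
  "bracket \<equiv> poisson_bracket (induced_metric x)"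

lemma bracket_eq:
  "v \<in> U \<Longrightarrow> bracket f k v =
    (partial 1 f v * partial 2 k v - partial 1 k v * partial 2 f v) / sqrt (detg v)"
  unfolding poisson_bracket_def by (simp add: det_induced_metric)

lemma bracket_coord:
  "v \<in> U \<Longrightarrow> bracket (coord x j) (coord x k) v = wedge (e 1 v) (e 2 v) j k / sqrt (detg v)"
  by (simp add: bracket_eq coord_partial wedge_def)

text \<open>Jacobi's formula: the product rule groups into the Cramer numerators of the two
  Christoffel symbols forming the trace.\<close>

lemma partial_detg:
  assumes "v \<in> U"
  shows "partial a detg v = 2 * detg v * (\<Gamma> 1 1 a v + \<Gamma> 2 2 a v)"
proof -
  have D: "detg v \<noteq> 0"
    using detg_pos[OF assms] by simp
  have dg: "(\<lambda>v. g i j v) differentiable at v" for i j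
    using assms by (intro differentiable differentiable_inner)
  have "partial a detg v = partial a (\<lambda>v. g 1 1 v * g 2 2 v - g 1 2 v * g 1 2 v) v"
    unfolding detg_def[abs_def] power2_eq_square ..
  also have "\<dots> = 2 * (g 2 2 v * (h 1 a v \<bullet> e 1 v) - g 1 2 v * (h 1 a v \<bullet> e 2 v))
      + 2 * (g 1 1 v * (h 2 a v \<bullet> e 2 v) - g 1 2 v * (h 2 a v \<bullet> e 1 v))"
    using assms by (simp add: partial_diff partial_mult partial_g dg differentiable_mult
      h_commute[of v a] inner_commute[of "e _ v" "h _ _ v"] algebra_simps)
  also have "\<dots> = 2 * detg v * (\<Gamma> 1 1 a v + \<Gamma> 2 2 a v)"
    using D by (simp add: \<Gamma>_def distrib_left)
  finally show ?thesis .
qed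

lemma partial_bracket_coord:
  assumes "v \<in> U"
  shows "partial a (bracket (coord x j) (coord x k)) v =
    (wedge (n 1 a v) (e 2 v) j k + wedge (e 1 v) (n a 2 v) j k) / sqrt (detg v)"
proof -
  define s where "s v = sqrt (detg v)" for v
  define P where "P v = wedge (e 1 v) (e 2 v) j k / s v" for v
  have s_pos: "s w > 0" if "w \<in> U" for w
    unfolding s_def using detg_pos[OF that] by simp
  have ds: "s differentiable at v"
    using differentiable_detg[OF assms] has_derivative_real_sqrt[where g = detg, OF detg_pos[OF assms]]
    unfolding s_def[abs_def] differentiable_def by blast
  have de: "(\<lambda>v. e b v $ i) differentiable at v" for b i
    using differentiable_vec_nth differentiable(2)[OF assms] .
  have dP: "P differentiable at v"
    unfolding P_def[abs_def] wedge_def using s_pos[OF assms] ds de by (auto intro!: derivative_intros)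
  \<comment> \<open>Differentiating \<open>s * s = detg\<close>, and below \<open>s * P\<close>, by
    the product rule gives the derivatives of the root and the quotient by solving linear
    equations.\<close>
  have "partial a (\<lambda>w. s w * s w) v = partial a detg v"
    using detg_pos by (intro partial_cong[OF open_U assms]) (auto simp: s_def less_imp_le)
  then have "2 * (s v * partial a s v) = 2 * detg v * (\<Gamma> 1 1 a v + \<Gamma> 2 2 a v)"
    using partial_mult[OF ds ds, of a] partial_detg[OF assms] by (simp add: mult_ac)
  also have "detg v = s v * s v"
    using detg_pos[OF assms] by (simp add: s_def)
  finally have s': "partial a s v = s v * (\<Gamma> 1 1 a v + \<Gamma> 2 2 a v)"
    using s_pos[OF assms] by simp
  have "partial a (\<lambda>w. s w * P w) v = partial a (\<lambda>w. wedge (e 1 w) (e 2 w) j k) v"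
    using s_pos by (intro partial_cong[OF open_U assms]) (simp add: P_def less_imp_neq[symmetric])
  then have "s v * partial a P v =
      wedge (h 1 a v) (e 2 v) j k + wedge (e 1 v) (h a 2 v) j k - partial a s v * P v"
    using partial_mult[OF ds dP, of a] h_commute[OF assms, of 1 a]
    by (simp add: wedge_def partial_diff partial_mult differentiable_mult de
      partial_vec_nth[OF differentiable(2)[OF assms]] algebra_simps)
  also have "partial a s v * P v = (\<Gamma> 1 1 a v + \<Gamma> 2 2 a v) * wedge (e 1 v) (e 2 v) j k"
    using s_pos[OF assms] by (simp add: s' P_def)
  \<comment> \<open>Passing from \<open>h\<close> to \<open>n\<close> subtracts tangential terms.
    Since a wedge of equal vectors vanishes, just \<open>\<Gamma> 1 1 a\<close> and
    \<open>\<Gamma> 2 a 2\<close> survive, and together they are the trace.\<close>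
  also have "wedge (h 1 a v) (e 2 v) j k + wedge (e 1 v) (h a 2 v) j k
      - (\<Gamma> 1 1 a v + \<Gamma> 2 2 a v) * wedge (e 1 v) (e 2 v) j k
      = wedge (n 1 a v) (e 2 v) j k + wedge (e 1 v) (n a 2 v) j k"
    unfolding n_def wedge_def \<Gamma>_commute[OF assms, of _ a 2] by (simp add: algebra_simps)
  finally have "partial a P v = (wedge (n 1 a v) (e 2 v) j k + wedge (e 1 v) (n a 2 v) j k) / s v"
    using s_pos[OF assms] by (simp add: field_simps)
  moreover have "partial a (bracket (coord x j) (coord x k)) v = partial a P v"
    by (rule partial_cong[OF open_U assms]) (simp add: P_def s_def bracket_coord)
  ultimately show ?thesis
    by (simp add: s_def)
qed

text \<open>The inner derivative and the outer bracket each carry a factor of one over the root of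
  \<open>detg\<close>, so no root remains.\<close>

lemma bracket_bracket_coord:
  assumes "v \<in> U"
  shows "bracket (bracket (coord x j) (coord x k)) (coord x l) v =
    ((wedge (n 1 1 v) (e 2 v) j k + wedge (e 1 v) (n 1 2 v) j k) * e 2 v $ l
      - (wedge (n 1 2 v) (e 2 v) j k + wedge (e 1 v) (n 2 2 v) j k) * e 1 v $ l) / detg v"
proof -
  have "detg v = sqrt (detg v) * sqrt (detg v)"
    using detg_pos[OF assms] by simp
  then show ?thesis
    unfolding bracket_eq[OF assms] partial_bracket_coord[OF assms] coord_partial[OF assms]
    by (simp add: diff_divide_distrib mult.commute)
qed

theorem gaussian_curvature_bracket:
  assumes "u \<in> U"
  shows "gaussian_curvature (induced_metric x) u = (\<Sum>j\<in>UNIV. \<Sum>k\<in>UNIV. \<Sum>l\<in>UNIV.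
    1/2 * bracket (bracket (coord x j) (coord x k)) (coord x k) u
        * bracket (bracket (coord x j) (coord x l)) (coord x l) u
    - 1/4 * bracket (bracket (coord x j) (coord x k)) (coord x l) u
        * bracket (bracket (coord x j) (coord x k)) (coord x l) u)"
proof -
  have "detg u \<noteq> 0"
    using detg_pos[OF assms] by simp
  then show ?thesis
    \<comment> \<open>With \<open>detg\<close> unfolded, the denominator matches \<open>D\<close> of
      \<open>second_form_identity\<close>, and the iterated brackets serve as
      \<open>T\<close>.\<close>
    unfolding gauss_equation[OF assms] detg_def
    by (intro second_form_identity[symmetric] n_orthogonal[OF assms]
        bracket_bracket_coord[OF assms, unfolded detg_def])
qed

end

theorem mainTheorem1:
  fixes S :: "(real^'m) set"
    and U :: "(real^2) set"
    and x :: "real^2 \<Rightarrow> real^'m"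
    and u :: "real^2"
    and br :: "(real^2 \<Rightarrow> real) \<Rightarrow> (real^2 \<Rightarrow> real) \<Rightarrow> real^2 \<Rightarrow> real"
    and X :: "'m \<Rightarrow> real^2 \<Rightarrow> real"
  defines "br \<equiv> poisson_bracket (induced_metric x)"
    and "X \<equiv> coord x"
  assumes "embedded_surface S"
    and "local_parametrization S U x"
    and "u \<in> U"
  shows "gaussian_curvature (induced_metric x) u =
    (\<Sum>j\<in>UNIV. \<Sum>k\<in>UNIV. \<Sum>l\<in>UNIV.
       1/2 * br (br (X j) (X k)) (X k) u * br (br (X j) (X l)) (X l) u
       - 1/4 * br (br (X j) (X k)) (X l) u * br (br (X j) (X k)) (X l) u)"
proof -
  \<comment> \<open>The claim is local: a parametrization supplies the open domain, the smoothness
    and the injective differential.\<close>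
  interpret immersion U x
    using assms(4) by unfold_locales (auto simp: local_parametrization_def)
  show ?thesis
    unfolding br_def X_def using assms(5) by (rule gaussian_curvature_bracket)
qed

end
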